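(* Let $\Gamma$ be a discrete group and let $E$ be a uniformly convex Banach $\Gamma$-module. Then $H^2_b(\Gamma;E)$ is Hausdorff.
   Context: A Banach $\Gamma$-module is a Banach space $E$ with an action of $\Gamma$ by linear isometries. It is uniformly convex if there is a continuous non-decreasing function $\delta:(0,2]\to(0,1]$ such that for all $\varepsilon\in(0,2]$ and all $u_1,u_2\in E$ with $\|u_1\|,\|u_2\|\le1$: if $\|u_1-u_2\|\ge\varepsilon$ then $\left\|\frac{u_1+u_2}{2}\right\|\le1-\delta(\varepsilon)$ (this coincides with the usual notion of uniform convexity of the space $E$). Bounded cohomology: for $n\ge0$ let $C^n_b(\Gamma;E)=\ell^\infty(\Gamma^n,E)$ be the Banach space of bounded maps $\Gamma^n\to E$ with the supremum norm (so it is $E$ for $n=0$). For $n\geq1$ the codifferential $d^n:C^{n-1}_b(\Gamma;E)\to C^n_b(\Gamma;E)$ is $$d^nf(\gamma_1,\dots,\gamma_n)=\gamma_1\cdot f(\gamma_2,\dots,\gamma_n)+\sum_{i=1}^{n-1}(-1)^if(\gamma_1,\dots,\gamma_i\gamma_{i+1},\dots,\gamma_n)+(-1)^nf(\gamma_1,\dots,\gamma_{n-1}).$$ Then $H^n_b(\Gamma;E)=\ker d^{n+1}/\operatorname{im}d^n$, called Hausdorff if its quotient topology is Hausdorff. *)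

theory Defs
  imports "HOL-Analysis.Analysis" "HOL-Algebra.Group_Action"
begin

text \<open>
  \<^const>\<open>group_action\<close> is the library's notion of a homomorphism from a group into the group of
  bijections of a set, here of the whole Banach space.
\<close>

locale banach_module = group_action G "UNIV :: 'e::banach set" act
  for G (structure) and act +
  assumes linear_act: "g \<in> carrier G \<Longrightarrow> linear (act g)"
    and norm_act: "g \<in> carrier G \<Longrightarrow> norm (act g x) = norm x"

definition uniformly_convex :: "'e::real_normed_vector itself \<Rightarrow> bool" where
  "uniformly_convex (_ :: 'e itself) \<longleftrightarrow>
     (\<exists>\<delta> :: real \<Rightarrow> real.
        continuous_on {0<..2} \<delta> \<and> mono_on {0<..2} \<delta> \<and> \<delta> \<in> {0<..2} \<rightarrow> {0<..1} \<and>
        (\<forall>\<epsilon>\<in>{0<..2}. \<forall>u v :: 'e. norm u \<le> 1 \<longrightarrow> norm v \<le> 1 \<longrightarrow> norm (u - v) \<ge> \<epsilon> \<longrightarrow>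
           norm ((u + v) /\<^sub>R 2) \<le> 1 - \<delta> \<epsilon>))"

definition tuples :: "('g, 'r) monoid_scheme \<Rightarrow> nat \<Rightarrow> 'g list set" where
  "tuples G n = {gs. length gs = n \<and> set gs \<subseteq> carrier G}"

text \<open>
  The space \<open>\<ell>\<^sup>\<infinity>(G\<^sup>n, E)\<close>. The functions are extensional, that is, \<^term>\<open>undefined\<close> outside
  \<^term>\<open>tuples G n\<close>, so that each bounded map on \<^term>\<open>tuples G n\<close> is represented exactly once.
\<close>

definition cochains :: "('g, 'r) monoid_scheme \<Rightarrow> nat \<Rightarrow> ('g list \<Rightarrow> 'e::banach) set" where
  "cochains G n = {f \<in> extensional (tuples G n). bounded (f ` tuples G n)}"

text \<open>\<^term>\<open>Met_TC.fdist\<close> is the supremum distance of bounded functions.\<close>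

definition cochain_topology ::
    "('g, 'r) monoid_scheme \<Rightarrow> nat \<Rightarrow> ('g list \<Rightarrow> 'e::banach) topology" where
  "cochain_topology G n = Metric_space.mtopology (cochains G n) (Met_TC.fdist (tuples G n))"

text \<open>
  The map \<open>d\<^sup>n\<close> from \<^term>\<open>cochains G (n - 1)\<close> to \<^term>\<open>cochains G n\<close>, meaningful for \<open>n \<ge> 1\<close> only.
  Lists are indexed from 0, so the entry \<open>\<gamma>\<^sub>i\<close> of the tuple is \<^term>\<open>gs ! (i - 1)\<close>.
\<close>

definition codifferential ::
    "('g, 'r) monoid_scheme \<Rightarrow> ('g \<Rightarrow> 'e::banach \<Rightarrow> 'e) \<Rightarrow> nat \<Rightarrow>
     ('g list \<Rightarrow> 'e) \<Rightarrow> 'g list \<Rightarrow> 'e" where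
  "codifferential G act n f =
     (\<lambda>gs\<in>tuples G n.
        act (gs ! 0) (f (tl gs))
        + (\<Sum>i = 1..n - 1. (-1) ^ i *\<^sub>R
             f (take (i - 1) gs @ [gs ! (i - 1) \<otimes>\<^bsub>G\<^esub> gs ! i] @ drop (i + 1) gs))
        + (-1) ^ n *\<^sub>R f (butlast gs))"

definition cocycles ::
    "('g, 'r) monoid_scheme \<Rightarrow> ('g \<Rightarrow> 'e::banach \<Rightarrow> 'e) \<Rightarrow> nat \<Rightarrow> ('g list \<Rightarrow> 'e) set" where
  "cocycles G act n =
     {f \<in> cochains G n. codifferential G act (n + 1) f = (\<lambda>gs\<in>tuples G (n + 1). 0)}"

text \<open>In degree 0 the incoming differential is zero by convention.\<close>

definition coboundaries ::
    "('g, 'r) monoid_scheme \<Rightarrow> ('g \<Rightarrow> 'e::banach \<Rightarrow> 'e) \<Rightarrow> nat \<Rightarrow> ('g list \<Rightarrow> 'e) set" where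
  "coboundaries G act n =
     (if n = 0 then {\<lambda>gs\<in>tuples G n. 0} else codifferential G act n ` cochains G (n - 1))"

definition cohomologous ::
    "('g, 'r) monoid_scheme \<Rightarrow> ('g \<Rightarrow> 'e::banach \<Rightarrow> 'e) \<Rightarrow> nat \<Rightarrow>
     (('g list \<Rightarrow> 'e) \<times> ('g list \<Rightarrow> 'e)) set" where
  "cohomologous G act n =
     {(f, f'). f \<in> cocycles G act n \<and> f' \<in> cocycles G act n \<and>
        (\<lambda>gs\<in>tuples G n. f gs - f' gs) \<in> coboundaries G act n}"

definition quotient_topology :: "'a topology \<Rightarrow> ('a \<times> 'a) set \<Rightarrow> 'a set topology" where
  "quotient_topology X R =
     topology (\<lambda>U. U \<subseteq> topspace X // R \<and> openin X {x \<in> topspace X. R `` {x} \<in> U})"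

text \<open>
  The space \<open>H\<^sup>n\<^sub>b(G; E)\<close>, with underlying set \<^term>\<open>cocycles G act n // cohomologous G act n\<close>.
\<close>

definition bounded_cohomology ::
    "('g, 'r) monoid_scheme \<Rightarrow> ('g \<Rightarrow> 'e::banach \<Rightarrow> 'e) \<Rightarrow> nat \<Rightarrow> ('g list \<Rightarrow> 'e) set topology" where
  "bounded_cohomology G act n =
     quotient_topology (subtopology (cochain_topology G n) (cocycles G act n))
       (cohomologous G act n)"

lemma openin_quotient_topology:
  "openin (quotient_topology X R) U \<longleftrightarrow>
     U \<subseteq> topspace X // R \<and> openin X {x \<in> topspace X. R `` {x} \<in> U}"
proof -
  let ?P = "\<lambda>U. U \<subseteq> topspace X // R \<and> openin X {x \<in> topspace X. R `` {x} \<in> U}"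
  have "istopology ?P"
    unfolding istopology_def
  proof (intro conjI allI impI)
    fix S T assume "?P S" "?P T"
    moreover have "{x \<in> topspace X. R `` {x} \<in> S \<inter> T} =
        {x \<in> topspace X. R `` {x} \<in> S} \<inter> {x \<in> topspace X. R `` {x} \<in> T}" by blast
    ultimately show "S \<inter> T \<subseteq> topspace X // R" "openin X {x \<in> topspace X. R `` {x} \<in> S \<inter> T}"
      by (auto simp: openin_Int)
  next
    fix \<K> assume K: "\<forall>K\<in>\<K>. ?P K"
    have "{x \<in> topspace X. R `` {x} \<in> \<Union>\<K>} = (\<Union>K\<in>\<K>. {x \<in> topspace X. R `` {x} \<in> K})" by blast
    with K show "\<Union>\<K> \<subseteq> topspace X // R" "openin X {x \<in> topspace X. R `` {x} \<in> \<Union>\<K>}"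
      by auto
  qed
  then show ?thesis
    by (simp add: quotient_topology_def topology_inverse')
qed

lemma topspace_quotient_topology: "topspace (quotient_topology X R) = topspace X // R"
proof -
  have "{x \<in> topspace X. R `` {x} \<in> topspace X // R} = topspace X"
    by (auto simp: quotientI)
  then have "openin (quotient_topology X R) (topspace X // R)"
    by (simp add: openin_quotient_topology)
  then show ?thesis
    by (meson openin_quotient_topology openin_subset openin_topspace subset_antisym)
qed

lemma quotient_map_quotient_topology:
  "quotient_map X (quotient_topology X R) (\<lambda>x. R `` {x})"
  unfolding quotient_map_def
  by (auto simp: topspace_quotient_topology openin_quotient_topology quotient_def)

lemma cochains_eq_fspace: "cochains G n = Met_TC.fspace (tuples G n)"
  by (auto simp: cochains_def Met_TC.fspace_def)

lemma topspace_cochain_topology: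
  fixes G :: "('g, 'r) monoid_scheme"
  shows "topspace (cochain_topology G n) = (cochains G n :: ('g list \<Rightarrow> 'e::banach) set)"
proof -
  interpret Metric_space "cochains G n :: ('g list \<Rightarrow> 'e) set" "Met_TC.fdist (tuples G n)"
    unfolding cochains_eq_fspace by (rule Met_TC.Metric_space_funspace)
  show ?thesis
    by (simp add: cochain_topology_def)
qed

lemma topspace_bounded_cohomology:
  "topspace (bounded_cohomology G act n) = cocycles G act n // cohomologous G act n"
proof -
  have "cocycles G act n \<subseteq> cochains G n"
    by (auto simp: cocycles_def)
  then show ?thesis
    by (simp add: bounded_cohomology_def topspace_quotient_topology topspace_cochain_topology
        inf.absorb2)
qed

end

theory Submission
  imports Defs
begin

text \<open>
  A bounded map \<open>f\<close> on the group with \<open>\<parallel>d f\<parallel> \<le> \<epsilon>\<close> defines maps \<open>x \<mapsto> \<gamma> x + f \<gamma>\<close> that form an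
  isometric affine action up to \<open>\<epsilon>\<close> and almost preserve the range of \<open>f\<close>. By uniform convexity,
  an approximate Chebyshev centre of that range is almost fixed, so that subtracting from \<open>f\<close> the
  coboundary it defines halves \<open>\<parallel>f\<parallel>\<close>, as long as \<open>\<parallel>f\<parallel>\<close> is at least a fixed multiple \<open>K \<epsilon>\<close> of the
  defect. As the subtraction does not change \<open>d f\<close>, iterating gives a map with the same differential
  and norm at most \<open>K \<epsilon>\<close>. Thus \<open>d\<close> has closed range.
\<close>

section \<open>Differentials of maps on the group\<close>

text \<open>This is \<open>codifferential\<close> in degree 2, written for maps on the group instead
  of on lists of length one.\<close>

definition defect ::
    "('g, 'r) monoid_scheme \<Rightarrow> ('g \<Rightarrow> 'e::banach \<Rightarrow> 'e) \<Rightarrow> ('g \<Rightarrow> 'e) \<Rightarrow> 'g \<Rightarrow> 'g \<Rightarrow> 'e" where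
  "defect G act f a b = act a (f b) - f (a \<otimes>\<^bsub>G\<^esub> b) + f a"

context banach_module
begin

lemma is_group: "group G"
  using group_hom group_hom.axioms(1) by blast

lemma act_mult:
  assumes "a \<in> carrier G" "b \<in> carrier G"
  shows "act (a \<otimes> b) x = act a (act b x)"
  using composition_rule[of x a b] assms by simp

lemma defect_diff:
  assumes "a \<in> carrier G"
  shows "defect G act (\<lambda>x. f x - g x) a b = defect G act f a b - defect G act g a b"
  by (simp add: defect_def linear_diff[OF linear_act[OF assms]])

text \<open>An instance of d d = 0: the added map \<open>x \<mapsto> act x v - v\<close> is the
  differential of the element \<open>v\<close>.\<close>

lemma defect_add_coboundary:
  assumes "a \<in> carrier G" "b \<in> carrier G"
  shows "defect G act (\<lambda>x. f x + act x v - v) a b = defect G act f a b"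
  using assms
  by (simp add: defect_def act_mult linear_diff[OF linear_act] linear_add[OF linear_act])

section \<open>Approximate Chebyshev centres and norm reduction\<close>

text \<open>The witness is an approximate Chebyshev centre \<open>c\<close> of the range of
  \<open>f\<close>. Its image \<open>f g + act g c\<close> is almost as good a centre; were the two
  more than R/2 apart, their midpoint would enclose the range in a ball of radius below the
  infimum.\<close>

lemma halve_norm_by_coboundary:
  fixes \<delta> R \<epsilon> :: real
  assumes convex: "\<And>u v :: 'e. norm u \<le> 1 \<Longrightarrow> norm v \<le> 1 \<Longrightarrow> norm (u - v) \<ge> 1/4 \<Longrightarrow>
      norm ((u + v) /\<^sub>R 2) \<le> 1 - \<delta>"
    and \<delta>: "0 < \<delta>" "\<delta> \<le> 1" and "\<epsilon> > 0" and R: "8 / \<delta> * \<epsilon> \<le> R"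
    and f: "\<And>a. a \<in> carrier G \<Longrightarrow> norm (f a) \<le> R"
    and defect: "\<And>a b. a \<in> carrier G \<Longrightarrow> b \<in> carrier G \<Longrightarrow> norm (defect G act f a b) \<le> \<epsilon>"
  shows "\<exists>v. \<forall>a\<in>carrier G. norm (f a + act a v - v) \<le> R / 2"
proof -
  interpret group G by (rule is_group)
  \<comment> \<open>\<open>S\<close> holds the radii of balls containing the range of
    \<open>f\<close>, so \<open>r\<close> is its Chebyshev radius. The centre \<open>c\<close> is
    taken for radius r + \<epsilon>, which avoids asking whether the infimum is attained.\<close>
  define S where "S = {\<rho>. \<exists>c. \<forall>a\<in>carrier G. norm (f a - c) \<le> \<rho>}"
  define r where "r = Inf S"
  have S_nonneg: "0 \<le> \<rho>" if "\<rho> \<in> S" for \<rho>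
    using that one_closed norm_ge_zero order_trans unfolding S_def by blast
  have "R \<in> S"
    unfolding S_def using f by (auto intro!: exI[of _ 0])
  have bdd: "bdd_below S"
    using S_nonneg by (rule bdd_belowI)
  have "r \<le> R"
    unfolding r_def using \<open>R \<in> S\<close> bdd by (rule cInf_lower)
  have "0 \<le> r"
    unfolding r_def using \<open>R \<in> S\<close> S_nonneg by (intro cInf_greatest) auto
  have "\<exists>\<rho>\<in>S. \<rho> < r + \<epsilon>"
    using cInf_lessD[of S "r + \<epsilon>"] \<open>R \<in> S\<close> \<open>\<epsilon> > 0\<close> unfolding r_def by auto
  then obtain \<rho> c where "\<rho> < r + \<epsilon>" "\<And>a. a \<in> carrier G \<Longrightarrow> norm (f a - c) \<le> \<rho>"
    unfolding S_def by blast
  then have c: "\<And>a. a \<in> carrier G \<Longrightarrow> norm (f a - c) \<le> r + \<epsilon>"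
    by (meson less_imp_le order_trans)
  \<comment> \<open>One \<epsilon> is the slack in the choice of \<open>c\<close>, the other the
    defect incurred in passing to \<open>c'\<close>. Thus s is a radius for both centres, and it is
    positive even if r = 0.\<close>
  define s where "s = r + 2 * \<epsilon>"
  have "s > 0"
    unfolding s_def using \<open>0 \<le> r\<close> \<open>\<epsilon> > 0\<close> by simp
  have "8 * \<epsilon> \<le> R * \<delta>"
    using R \<delta> by (simp add: field_simps)
  moreover have "R * \<delta> \<le> R"
    using \<delta> \<open>0 \<le> r\<close> \<open>r \<le> R\<close> by (simp add: mult_left_le)
  \<comment> \<open>This turns a distance above R/2 into one of at least 1/4 after division by s,
    the separation in \<open>convex\<close>.\<close>
  ultimately have "s \<le> 2 * R"
    unfolding s_def using \<open>r \<le> R\<close> \<open>\<epsilon> > 0\<close> by simp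
  have "norm (f g + act g c - c) \<le> R / 2" if g: "g \<in> carrier G" for g
  proof (rule ccontr)
    assume far: "\<not> norm (f g + act g c - c) \<le> R / 2"
    define c' where "c' = f g + act g c"
    have c': "norm (f b - c') \<le> s" if b: "b \<in> carrier G" for b
    proof -
      \<comment> \<open>Writing b as a product with left factor g lets the isometry
        \<open>act g\<close> carry the bound for \<open>c\<close> over to \<open>c'\<close>, at the
        cost of one defect.\<close>
      have b': "inv g \<otimes> b \<in> carrier G" "g \<otimes> (inv g \<otimes> b) = b"
        using g b by (auto simp: m_assoc[symmetric])
      have "f b - c' = act g (f (inv g \<otimes> b) - c) - defect G act f g (inv g \<otimes> b)"
        by (simp add: defect_def c'_def b' linear_diff[OF linear_act[OF g]])
      also have "norm \<dots> \<le> (r + \<epsilon>) + \<epsilon>"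
        using c[OF b'(1)] defect[OF g b'(1)] norm_act[OF g]
        by (metis add_mono norm_triangle_le_diff)
      finally show ?thesis by (simp add: s_def)
    qed
    \<comment> \<open>Both centres lie within s of \<open>f b\<close> and are at least s/4 apart, so
      convexity brings their midpoint closer to \<open>f b\<close> by the factor 1 -
      \<delta>.\<close>
    have "norm (f b - (c + c') /\<^sub>R 2) \<le> s * (1 - \<delta>)" if b: "b \<in> carrier G" for b
    proof -
      let ?u = "(f b - c) /\<^sub>R s" and ?v = "(f b - c') /\<^sub>R s"
      have "norm ?u \<le> 1" "norm ?v \<le> 1"
        using c[OF b] c'[OF b] \<open>s > 0\<close> \<open>\<epsilon> > 0\<close> by (auto simp: s_def inverse_eq_divide)
      moreover have "norm (?u - ?v) \<ge> 1/4"
      proof -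
        have "?u - ?v = (c' - c) /\<^sub>R s"
          by (simp add: algebra_simps)
        then have "norm (?u - ?v) = norm (c' - c) / s"
          using \<open>s > 0\<close> by (simp add: divide_inverse mult.commute)
        moreover have "s / 4 \<le> norm (c' - c)"
          using far \<open>s \<le> 2 * R\<close> unfolding c'_def by linarith
        ultimately show ?thesis
          using \<open>s > 0\<close> by (simp only: pos_le_divide_eq)
      qed
      ultimately have "norm ((?u + ?v) /\<^sub>R 2) \<le> 1 - \<delta>"
        by (rule convex)
      moreover have "f b - (c + c') /\<^sub>R 2 = s *\<^sub>R ((?u + ?v) /\<^sub>R 2)"
      proof -
        have "f b = (1/2) *\<^sub>R f b + (1/2) *\<^sub>R f b"
          by (simp flip: scaleR_add_left)
        then show ?thesis
          using \<open>s > 0\<close> by (simp add: algebra_simps)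
      qed
      ultimately show ?thesis
        using \<open>s > 0\<close> by simp
    qed
    then have "s * (1 - \<delta>) \<in> S"
      unfolding S_def by blast
    then have "r \<le> s * (1 - \<delta>)"
      unfolding r_def using bdd by (rule cInf_lower)
    then have "s * \<delta> \<le> 2 * \<epsilon>"
      by (simp add: s_def algebra_simps)
    \<comment> \<open>Both centres are within s of \<open>f g\<close>, so \<open>far\<close> gives R
      < 4 s. Then R \<delta> < 4 s \<delta> \<le> 8 \<epsilon> \<le> R \<delta>, which explains the
      8 in the hypothesis on R.\<close>
    moreover have "norm (c' - c) \<le> 2 * s"
    proof -
      have "norm (c' - c) \<le> norm (f g - c) + norm (f g - c')"
        using norm_triangle_ineq4[of "f g - c" "f g - c'"] by simp
      then show ?thesis
        using c[OF g] c'[OF g] \<open>\<epsilon> > 0\<close> by (simp add: s_def)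
    qed
    then have "R * \<delta> < 4 * s * \<delta>"
      using far \<delta> unfolding c'_def by (intro mult_strict_right_mono) auto
    ultimately show False
      using \<open>8 * \<epsilon> \<le> R * \<delta>\<close> by linarith
  qed
  then show ?thesis by blast
qed

text \<open>Halving is repeated until the norm is at most K \<epsilon>. The number of steps depends
  on \<open>f\<close>, but \<open>K\<close> depends only on the modulus of convexity at 1/4; this
  uniformity yields the closed range.\<close>

lemma bounded_by_defect_up_to_coboundary:
  assumes "uniformly_convex TYPE('e)"
  obtains K :: real where "K > 0"
    "\<And>f \<epsilon>. \<lbrakk>\<epsilon> > 0; bounded (f ` carrier G);
        \<And>a b. a \<in> carrier G \<Longrightarrow> b \<in> carrier G \<Longrightarrow> norm (defect G act f a b) \<le> \<epsilon>\<rbrakk> \<Longrightarrow>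
      \<exists>v. \<forall>a\<in>carrier G. norm (f a + act a v - v) \<le> K * \<epsilon>"
proof -
  obtain \<delta> :: "real \<Rightarrow> real" where \<delta>: "\<delta> \<in> {0<..2} \<rightarrow> {0<..1}"
    and convex: "\<forall>\<epsilon>\<in>{0<..2}. \<forall>u v :: 'e. norm u \<le> 1 \<longrightarrow> norm v \<le> 1 \<longrightarrow> norm (u - v) \<ge> \<epsilon> \<longrightarrow>
           norm ((u + v) /\<^sub>R 2) \<le> 1 - \<delta> \<epsilon>"
    using assms unfolding uniformly_convex_def by blast
  define K where "K = 8 / \<delta> (1/4)"
  have \<delta>': "0 < \<delta> (1/4)" "\<delta> (1/4) \<le> 1"
    using \<delta> by (auto simp: Pi_iff)
  then have "K > 0"
    by (simp add: K_def)
  \<comment> \<open>Here n counts the halvings still to be made. The map \<open>f\<close> is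
    generalised in the induction because each halving replaces it.\<close>
  have step: "\<exists>v. \<forall>a\<in>carrier G. norm (f a + act a v - v) \<le> K * \<epsilon>"
    if "\<epsilon> > 0" "R \<le> K * \<epsilon> * 2 ^ n" "\<And>a. a \<in> carrier G \<Longrightarrow> norm (f a) \<le> R"
      "\<And>a b. a \<in> carrier G \<Longrightarrow> b \<in> carrier G \<Longrightarrow> norm (defect G act f a b) \<le> \<epsilon>"
    for f and \<epsilon> R :: real and n
    using that
  proof (induction n arbitrary: f R)
    case 0
    have "f a + act a 0 - 0 = f a" if "a \<in> carrier G" for a
      using linear_0[OF linear_act[OF that]] by simp
    with 0 show ?case
      by (intro exI[of _ 0]) fastforce
  next
    case (Suc n)
    \<comment> \<open>Halving is applied with this bound in place of \<open>R\<close>, since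
      \<open>R\<close> itself may lie below the threshold K \<epsilon>.\<close>
    let ?R = "K * \<epsilon> * 2 ^ Suc n"
    have "1 \<le> (2::real) ^ Suc n"
      by (rule one_le_power) simp
    then have "K * \<epsilon> \<le> ?R"
      using \<open>K > 0\<close> \<open>\<epsilon> > 0\<close> mult_left_mono[of 1 "2 ^ Suc n" "K * \<epsilon>"] by simp
    have "\<exists>v. \<forall>a\<in>carrier G. norm (f a + act a v - v) \<le> ?R / 2"
    proof (rule halve_norm_by_coboundary[OF _ \<delta>'])
      show "norm ((u + v) /\<^sub>R 2) \<le> 1 - \<delta> (1/4)"
        if "norm u \<le> 1" "norm v \<le> 1" "norm (u - v) \<ge> 1/4" for u v :: 'e
        using convex that by simp
      show "8 / \<delta> (1/4) * \<epsilon> \<le> ?R"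
        using \<open>K * \<epsilon> \<le> ?R\<close> by (simp add: K_def)
      show "norm (f a) \<le> ?R" if "a \<in> carrier G" for a
        using Suc.prems(2) Suc.prems(3)[OF that] by linarith
    qed (use Suc.prems in auto)
    then obtain v where v: "\<And>a. a \<in> carrier G \<Longrightarrow> norm (f a + act a v - v) \<le> ?R / 2"
      by blast
    have "\<exists>w. \<forall>a\<in>carrier G. norm (f a + act a v - v + act a w - w) \<le> K * \<epsilon>"
      using Suc.prems v by (intro Suc.IH[of "?R / 2"]) (auto simp: defect_add_coboundary)
    then obtain w where "\<And>a. a \<in> carrier G \<Longrightarrow> norm (f a + act a v - v + act a w - w) \<le> K * \<epsilon>"
      by blast
    then show ?case
      by (intro exI[of _ "v + w"]) (auto simp: linear_add[OF linear_act] algebra_simps)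
  qed
  have "\<exists>v. \<forall>a\<in>carrier G. norm (f a + act a v - v) \<le> K * \<epsilon>"
    if \<epsilon>: "\<epsilon> > 0" and f: "bounded (f ` carrier G)"
      and d: "\<And>a b. a \<in> carrier G \<Longrightarrow> b \<in> carrier G \<Longrightarrow> norm (defect G act f a b) \<le> \<epsilon>" for f \<epsilon>
  proof -
    obtain R where R: "\<And>a. a \<in> carrier G \<Longrightarrow> norm (f a) \<le> R"
      using f by (auto simp: bounded_iff)
    obtain n where "R / (K * \<epsilon>) < 2 ^ n"
      using real_arch_pow[of 2] by auto
    then have "R \<le> K * \<epsilon> * 2 ^ n"
      using \<open>K > 0\<close> \<epsilon> by (simp add: field_simps)
    then show ?thesis
      using step[OF \<epsilon> _ R d] by blast
  qed
  with \<open>K > 0\<close> show thesis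
    using that by blast
qed

section \<open>Closed range of the differential\<close>

text \<open>Consecutive approximate preimages of \<open>h\<close> differ by a map of small defect,
  which is small up to a coboundary. Correcting by these coboundaries keeps the defects and makes
  the sequence converge to a bounded preimage.\<close>

lemma defect_range_closed:
  assumes convex: "uniformly_convex TYPE('e)"
    and approx: "\<And>\<epsilon>. \<epsilon> > 0 \<Longrightarrow> \<exists>f. bounded (f ` carrier G) \<and>
      (\<forall>a\<in>carrier G. \<forall>b\<in>carrier G. norm (h a b - defect G act f a b) \<le> \<epsilon>)"
  shows "\<exists>f. bounded (f ` carrier G) \<and> (\<forall>a\<in>carrier G. \<forall>b\<in>carrier G. defect G act f a b = h a b)"
proof -
  interpret group G by (rule is_group)
  obtain K :: real where "K > 0" and K: "\<And>f \<epsilon>. \<lbrakk>\<epsilon> > 0; bounded (f ` carrier G);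
        \<And>a b. a \<in> carrier G \<Longrightarrow> b \<in> carrier G \<Longrightarrow> norm (defect G act f a b) \<le> \<epsilon>\<rbrakk> \<Longrightarrow>
      \<exists>v. \<forall>a\<in>carrier G. norm (f a + act a v - v) \<le> K * \<epsilon>"
    using bounded_by_defect_up_to_coboundary[OF convex] by blast
  obtain f where bdd: "\<And>n::nat. bounded (f n ` carrier G)"
    and f: "\<And>n a b. a \<in> carrier G \<Longrightarrow> b \<in> carrier G \<Longrightarrow>
      norm (h a b - defect G act (f n) a b) \<le> (1/2) ^ n"
  proof -
    have "\<forall>n::nat. \<exists>f. bounded (f ` carrier G) \<and>
        (\<forall>a\<in>carrier G. \<forall>b\<in>carrier G. norm (h a b - defect G act f a b) \<le> (1/2) ^ n)"
      using approx by simp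
    then show thesis
      using that by metis
  qed
  have "\<exists>v. \<forall>a\<in>carrier G. norm (f (Suc n) a - f n a + act a v - v) \<le> K * (2 * (1/2) ^ n)" for n
  proof (rule K)
    show "bounded ((\<lambda>a. f (Suc n) a - f n a) ` carrier G)"
      by (rule bounded_minus_comp[OF bdd bdd])
    fix a b assume ab: "a \<in> carrier G" "b \<in> carrier G"
    have "norm (defect G act (f (Suc n)) a b - defect G act (f n) a b)
        = norm ((h a b - defect G act (f n) a b) - (h a b - defect G act (f (Suc n)) a b))"
      by simp
    also have "\<dots> \<le> (1/2) ^ n + (1/2) ^ Suc n"
      by (intro norm_triangle_le_diff add_mono f[OF ab])
    also have "\<dots> \<le> 2 * (1/2) ^ n"
      by simp
    finally show "norm (defect G act (\<lambda>a. f (Suc n) a - f n a) a b) \<le> 2 * (1/2) ^ n"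
      using ab by (simp add: defect_diff)
  qed simp
  then obtain v where v: "\<And>n a. a \<in> carrier G \<Longrightarrow>
      norm (f (Suc n) a - f n a + act a (v n) - v n) \<le> K * (2 * (1/2) ^ n)"
    by metis
  \<comment> \<open>The corrections accumulate in \<open>V\<close>: \<open>F n\<close> has the same
    defect as \<open>f n\<close>, but its successive differences are bounded by a geometric
    sequence.\<close>
  define V where "V n = (\<Sum>i<n. v i)" for n
  define F where "F n a = f n a + act a (V n) - V n" for n a
  have F_Suc: "F (Suc n) a - F n a = f (Suc n) a - f n a + act a (v n) - v n"
    if "a \<in> carrier G" for n a
    by (simp add: F_def V_def linear_add[OF linear_act[OF that]])
  have summ: "summable (\<lambda>n. K * (2 * (1/2) ^ n) :: real)"
    by (intro summable_mult summable_geometric) simp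
  \<comment> \<open>The limit is written as a telescoping series, so that one geometric majorant
    gives both convergence and boundedness.\<close>
  define L where "L a = F 0 a + (\<Sum>n. F (Suc n) a - F n a)" for a
  have L: "(\<lambda>n. F n a) \<longlonglongrightarrow> L a" and L_bound: "norm (L a) \<le> norm (f 0 a) + (\<Sum>n. K * (2 * (1/2) ^ n))"
    if a: "a \<in> carrier G" for a
  proof -
    have le: "norm (F (Suc n) a - F n a) \<le> K * (2 * (1/2) ^ n)" for n
      using v[OF a] F_Suc[OF a] by simp
    then have "summable (\<lambda>n. F (Suc n) a - F n a)"
      by (intro summable_comparison_test'[OF summ, of 0])
    then have "(\<lambda>n. \<Sum>i<n. F (Suc i) a - F i a) \<longlonglongrightarrow> (\<Sum>n. F (Suc n) a - F n a)"
      by (rule summable_LIMSEQ)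
    then have "(\<lambda>n. F 0 a + (\<Sum>i<n. F (Suc i) a - F i a)) \<longlonglongrightarrow> L a"
      unfolding L_def by (intro tendsto_intros)
    then show "(\<lambda>n. F n a) \<longlonglongrightarrow> L a"
      using sum_lessThan_telescope[of "\<lambda>n. F n a"] by simp
    have "norm (\<Sum>n. F (Suc n) a - F n a) \<le> (\<Sum>n. K * (2 * (1/2) ^ n))"
      using le summ by (rule norm_suminf_le)
    moreover have "F 0 a = f 0 a"
      by (simp add: F_def V_def linear_0[OF linear_act[OF a]])
    ultimately show "norm (L a) \<le> norm (f 0 a) + (\<Sum>n. K * (2 * (1/2) ^ n))"
      unfolding L_def by (metis norm_triangle_le add_left_mono)
  qed
  obtain R where "\<And>a. a \<in> carrier G \<Longrightarrow> norm (f 0 a) \<le> R"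
    using bdd[of 0] by (auto simp: bounded_iff)
  then have "norm (L a) \<le> R + (\<Sum>n. K * (2 * (1/2) ^ n))" if "a \<in> carrier G" for a
    using L_bound[OF that] that by (meson add_right_mono order_trans)
  then have "bounded (L ` carrier G)"
    by (intro boundedI) blast
  moreover have "defect G act L a b = h a b" if ab: "a \<in> carrier G" "b \<in> carrier G" for a b
  proof (rule LIMSEQ_unique)
    have "bounded_linear (act a)"
      using linear_act[OF ab(1)] norm_act[OF ab(1)]
      by (intro bounded_linear.intro bounded_linear_axioms.intro) (auto intro!: exI[of _ 1])
    then show "(\<lambda>n. defect G act (F n) a b) \<longlonglongrightarrow> defect G act L a b"
      unfolding defect_def using ab
      by (intro tendsto_intros L bounded_linear.tendsto[of "act a"]) auto
    have "(\<lambda>n. h a b - defect G act (F n) a b) \<longlonglongrightarrow> 0"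
    proof (rule Lim_null_comparison)
      show "\<forall>\<^sub>F n in sequentially. norm (h a b - defect G act (F n) a b) \<le> (1/2) ^ n"
        using f[OF ab] ab unfolding F_def by (simp add: defect_add_coboundary)
    qed (simp add: LIMSEQ_power_zero)
    then have "(\<lambda>n. h a b - (h a b - defect G act (F n) a b)) \<longlonglongrightarrow> h a b - 0"
      by (intro tendsto_intros)
    then show "(\<lambda>n. defect G act (F n) a b) \<longlonglongrightarrow> h a b"
      by simp
  qed
  ultimately show ?thesis by blast
qed

section \<open>Coboundaries in degree two\<close>

text \<open>Lists of length one correspond to group elements, so 1-cochains are bounded maps on the
  group.\<close>

lemma coboundaries_2:
  "coboundaries G act 2 =
    {\<lambda>gs\<in>tuples G 2. defect G act f (gs ! 0) (gs ! 1) | f. bounded (f ` carrier G)}"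
    (is "?L = ?R")
proof -
  interpret group G by (rule is_group)
  have d: "codifferential G act 2 f = (\<lambda>gs\<in>tuples G 2. defect G act (\<lambda>a. f [a]) (gs ! 0) (gs ! 1))"
    for f :: "'a list \<Rightarrow> 'e"
    unfolding codifferential_def
    by (rule restrict_ext) (auto simp: tuples_def defect_def length_Suc_conv numeral_2_eq_2)
  have tuples_1: "tuples G 1 = (\<lambda>a. [a]) ` carrier G"
    by (auto simp: tuples_def length_Suc_conv)
  show ?thesis
  proof (intro equalityI subsetI)
    fix h assume "h \<in> ?L"
    then obtain f where f: "f \<in> cochains G 1" "h = codifferential G act 2 f"
      by (auto simp: coboundaries_def)
    then have "bounded ((\<lambda>a. f [a]) ` carrier G)"
      by (simp add: cochains_def tuples_1[simplified] image_image)
    with f show "h \<in> ?R"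
      unfolding d by blast
  next
    fix h assume "h \<in> ?R"
    then obtain f where f: "bounded (f ` carrier G)"
      and h: "h = (\<lambda>gs\<in>tuples G 2. defect G act f (gs ! 0) (gs ! 1))"
      by blast
    let ?f = "\<lambda>gs\<in>tuples G 1. f (gs ! 0)"
    have "?f \<in> cochains G 1"
      using f by (simp add: cochains_def tuples_1[simplified] image_image)
    moreover have "h = codifferential G act 2 ?f"
      unfolding d h
      by (rule restrict_ext) (auto simp: tuples_def defect_def length_Suc_conv numeral_2_eq_2)
    ultimately show "h \<in> ?L"
      by (auto simp: coboundaries_def)
  qed
qed

end

section \<open>Hausdorff quotients by closed subgroups\<close>

lemma norm_diff_le_fdist:
  assumes "f \<in> cochains G n" "g \<in> cochains G n" "gs \<in> tuples G n"
  shows "norm (f gs - g gs) \<le> Met_TC.fdist (tuples G n) f g"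
proof -
  have "bdd_above ((\<lambda>x. dist (f x) (g x)) ` tuples G n)"
    by (rule Met_TC.bdd_above_dist) (use assms cochains_eq_fspace in auto)
  then show ?thesis
    using assms
    by (auto simp: Met_TC.fdist_def dist_norm simp flip: cochains_eq_fspace intro!: cSUP_upper)
qed

text \<open>A quotient by a closed subgroup is Hausdorff: distinct classes have positive distance,
  and balls of half that size separate them. The last assumption expresses closedness by uniform
  approximation.\<close>

lemma Hausdorff_space_bounded_cohomology:
  fixes G :: "('g, 'r) monoid_scheme" and act :: "'g \<Rightarrow> 'e::banach \<Rightarrow> 'e"
  assumes zero: "(\<lambda>gs\<in>tuples G n. 0) \<in> coboundaries G act n"
    and diff: "\<And>b c. b \<in> coboundaries G act n \<Longrightarrow> c \<in> coboundaries G act n \<Longrightarrow>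
      (\<lambda>gs\<in>tuples G n. b gs - c gs) \<in> coboundaries G act n"
    and closed: "\<And>h. h \<in> extensional (tuples G n) \<Longrightarrow>
      (\<And>\<epsilon>::real. \<epsilon> > 0 \<Longrightarrow>
        \<exists>b\<in>coboundaries G act n. \<forall>gs\<in>tuples G n. norm (h gs - b gs) \<le> \<epsilon>) \<Longrightarrow>
      h \<in> coboundaries G act n"
  shows "Hausdorff_space (bounded_cohomology G act n)"
proof -
  let ?T = "tuples G n" and ?Z = "cocycles G act n" and ?B = "coboundaries G act n"
  let ?R = "cohomologous G act n"
  interpret M: Metric_space "cochains G n :: ('g list \<Rightarrow> 'e) set" "Met_TC.fdist ?T"
    unfolding cochains_eq_fspace by (rule Met_TC.Metric_space_funspace)
  have ZC: "?Z \<subseteq> cochains G n"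
    by (auto simp: cocycles_def)
  have refl: "x \<in> ?R `` {x}" if "x \<in> ?Z" for x
    using that zero by (simp add: cohomologous_def)
  \<comment> \<open>The open ball of radius e about the class of \<open>f\<close> in the quotient
    seminorm, pulled back to cocycles. The bound e' < e stands for a supremum strictly below
    e.\<close>
  define V where "V e f = {x \<in> ?Z. \<exists>b\<in>?B. \<exists>e'<e. \<forall>gs\<in>?T. norm (x gs - f gs - b gs) \<le> e'}"
    for e :: real and f
  have V_cohomologous: "x \<in> V e f" if "y \<in> V e f" "(y, x) \<in> ?R" for e f x y
  proof -
    obtain b e' where b: "b \<in> ?B" "e' < e" "\<And>gs. gs \<in> ?T \<Longrightarrow> norm (y gs - f gs - b gs) \<le> e'"
      using \<open>y \<in> V e f\<close> by (auto simp: V_def)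
    \<comment> \<open>The coboundary y - x is absorbed into b, leaving the difference to be
      estimated unchanged. So \<open>V\<close> is saturated.\<close>
    let ?c = "\<lambda>gs\<in>?T. b gs - (\<lambda>gs\<in>?T. y gs - x gs) gs"
    have "(\<lambda>gs\<in>?T. y gs - x gs) \<in> ?B"
      using that(2) by (simp add: cohomologous_def)
    with b(1) have "?c \<in> ?B"
      by (rule diff)
    moreover have "norm (x gs - f gs - ?c gs) \<le> e'" if "gs \<in> ?T" for gs
      using b(3)[OF that] that by (simp add: algebra_simps)
    moreover have "x \<in> ?Z"
      using that(2) by (simp add: cohomologous_def)
    ultimately show ?thesis
      unfolding V_def using \<open>e' < e\<close> by blast
  qed
  have V_open: "openin (subtopology (cochain_topology G n) ?Z) (V e f)" for e f
  proof -
    let ?W = "{x \<in> cochains G n. \<exists>b\<in>?B. \<exists>e'<e. \<forall>gs\<in>?T. norm (x gs - f gs - b gs) \<le> e'}"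
    have "openin (cochain_topology G n) ?W"
      unfolding cochain_topology_def M.openin_mtopology
    proof (intro conjI allI impI)
      fix x assume "x \<in> ?W"
      then obtain b e' where x: "x \<in> cochains G n" and b: "b \<in> ?B" "e' < e"
        "\<And>gs. gs \<in> ?T \<Longrightarrow> norm (x gs - f gs - b gs) \<le> e'"
        by blast
      \<comment> \<open>Half of the gap e - e' is spent on moving from x to y; the other half keeps
        the new bound (e + e')/2 below e.\<close>
      have "y \<in> ?W" if y: "y \<in> M.mball x ((e - e') / 2)" for y
      proof -
        have y': "y \<in> cochains G n" "Met_TC.fdist ?T x y \<le> (e - e') / 2"
          using y by auto
        have "norm (y gs - f gs - b gs) \<le> (e + e') / 2" if gs: "gs \<in> ?T" for gs
        proof -
          have "norm (x gs - y gs) \<le> (e - e') / 2"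
            using norm_diff_le_fdist[OF x y'(1) gs] y'(2) by linarith
          then have "norm ((x gs - f gs - b gs) - (x gs - y gs)) \<le> e' + (e - e') / 2"
            by (rule norm_triangle_le_diff[OF add_mono[OF b(3)[OF gs]]])
          then show ?thesis
            by (simp add: field_simps)
        qed
        moreover have "(e + e') / 2 < e"
          using b(2) by simp
        ultimately show ?thesis
          using y'(1) b(1) by blast
      qed
      then show "\<exists>r>0. M.mball x r \<subseteq> ?W"
        using b(2) by (intro exI[of _ "(e - e') / 2"]) auto
    qed auto
    moreover have "V e f = ?Z \<inter> ?W"
      using ZC by (auto simp: V_def)
    ultimately show ?thesis
      by (auto simp: openin_subtopology)
  qed
  define U where "U e f = (\<lambda>x. ?R `` {x}) ` V e f" for e f
  \<comment> \<open>By saturation the preimage of \<open>U e f\<close> is exactly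
    \<open>V e f\<close>, so openness passes to the quotient.\<close>
  have in_U: "?R `` {x} \<in> U e f \<longleftrightarrow> x \<in> V e f" if "x \<in> ?Z" for x e f
  proof
    assume "?R `` {x} \<in> U e f"
    then obtain y where y: "y \<in> V e f" "?R `` {x} = ?R `` {y}"
      by (auto simp: U_def)
    then have "(y, x) \<in> ?R"
      using refl[OF that] by (metis Image_singleton_iff)
    with y(1) show "x \<in> V e f"
      by (rule V_cohomologous)
  next
    assume "x \<in> V e f"
    then show "?R `` {x} \<in> U e f"
      unfolding U_def by (rule imageI)
  qed
  have U_open: "openin (bounded_cohomology G act n) (U e f)" for e f
  proof -
    have top: "topspace (subtopology (cochain_topology G n) ?Z) = ?Z"
      using ZC by (auto simp: topspace_cochain_topology)
    have "V e f \<subseteq> ?Z"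
      by (auto simp: V_def)
    then have "U e f \<subseteq> ?Z // ?R"
      by (auto simp: U_def quotientI)
    moreover have "{x \<in> ?Z. ?R `` {x} \<in> U e f} = V e f"
      using in_U \<open>V e f \<subseteq> ?Z\<close> by blast
    ultimately show ?thesis
      unfolding bounded_cohomology_def openin_quotient_topology top using V_open by simp
  qed
  show ?thesis
    unfolding Hausdorff_space_def topspace_bounded_cohomology
  proof (intro allI impI)
    fix p q assume pq: "p \<in> ?Z // ?R \<and> q \<in> ?Z // ?R \<and> p \<noteq> q"
    then obtain f g where f: "f \<in> ?Z" "p = ?R `` {f}" and g: "g \<in> ?Z" "q = ?R `` {g}"
      by (auto simp: quotient_def)
    let ?h = "\<lambda>gs\<in>?T. f gs - g gs"
    have self: "x \<in> V e x" if "x \<in> ?Z" "e > 0" for x e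
      using that zero by (auto simp: V_def intro!: bexI[of _ "\<lambda>gs\<in>?T. 0"] exI[of _ 0])
    have "?h \<notin> ?B"
    proof
      assume "?h \<in> ?B"
      have "(\<lambda>gs\<in>?T. (\<lambda>gs\<in>?T. 0) gs - ?h gs) \<in> ?B"
        using zero \<open>?h \<in> ?B\<close> by (rule diff)
      then have gf: "(\<lambda>gs\<in>?T. g gs - f gs) \<in> ?B"
        by (simp cong: restrict_cong)
      have shift: "(\<lambda>gs\<in>?T. v gs - x gs) \<in> ?B"
        if "(\<lambda>gs\<in>?T. u gs - x gs) \<in> ?B" "(\<lambda>gs\<in>?T. u gs - v gs) \<in> ?B" for u v x
        using diff[OF that] by (simp cong: restrict_cong)
      have "?R `` {f} = ?R `` {g}"
        using f(1) g(1) shift[of f _ g, OF _ \<open>?h \<in> ?B\<close>] shift[of g _ f, OF _ gf]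
        by (auto simp: cohomologous_def)
      then show False
        using pq f g by simp
    qed
    \<comment> \<open>The contrapositive of \<open>closed\<close>: some e > 0 is a lower bound for
      the distance from f - g to the coboundaries.\<close>
    then obtain e :: real where "e > 0"
      and e: "\<And>b. b \<in> ?B \<Longrightarrow> \<exists>gs\<in>?T. \<not> norm (?h gs - b gs) \<le> e"
      using closed[of ?h] by (meson restrict_extensional)
    have "disjnt (U (e/2) f) (U (e/2) g)"
    proof -
      have False if xf: "x \<in> V (e/2) f" and xg: "x \<in> V (e/2) g" for x
      proof -
        obtain b e1 where b: "b \<in> ?B" "e1 < e/2" "\<And>gs. gs \<in> ?T \<Longrightarrow> norm (x gs - f gs - b gs) \<le> e1"
          using xf by (auto simp: V_def)
        obtain c e2 where c: "c \<in> ?B" "e2 < e/2" "\<And>gs. gs \<in> ?T \<Longrightarrow> norm (x gs - g gs - c gs) \<le> e2"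
          using xg by (auto simp: V_def)
        \<comment> \<open>If x were close to both classes, cancelling x would put f - g within e of
          the coboundary c - b.\<close>
        let ?k = "\<lambda>gs\<in>?T. c gs - b gs"
        obtain gs where gs: "gs \<in> ?T" "\<not> norm (?h gs - ?k gs) \<le> e"
          using e[OF diff[OF c(1) b(1)]] by blast
        have "?h gs - ?k gs = (x gs - g gs - c gs) - (x gs - f gs - b gs)"
          using gs(1) by simp
        also have "norm \<dots> \<le> e2 + e1"
          by (rule norm_triangle_le_diff[OF add_mono[OF c(3)[OF gs(1)] b(3)[OF gs(1)]]])
        finally show False
          using gs(2) b(2) c(2) by linarith
      qed
      moreover have "x \<in> V (e/2) g" if "x \<in> V (e/2) f" "?R `` {x} \<in> U (e/2) g" for x
      proof -
        have "x \<in> ?Z"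
          using that(1) by (simp add: V_def)
        then show ?thesis
          using that(2) in_U by blast
      qed
      ultimately show ?thesis
        unfolding disjnt_iff U_def[of _ f] by blast
    qed
    moreover have "p \<in> U (e/2) f" "q \<in> U (e/2) g"
      unfolding f(2) g(2) U_def using f(1) g(1) self \<open>e > 0\<close> by (auto intro: imageI)
    ultimately show "\<exists>U V. openin (bounded_cohomology G act n) U \<and>
        openin (bounded_cohomology G act n) V \<and> p \<in> U \<and> q \<in> V \<and> disjnt U V"
      using U_open by blast
  qed
qed

section \<open>Second bounded cohomology with uniformly convex coefficients\<close>

theorem corollaryD:
  fixes G :: "('g, 'r) monoid_scheme" and act :: "'g \<Rightarrow> 'e::banach \<Rightarrow> 'e"
  assumes "banach_module G act"
    and "uniformly_convex TYPE('e)"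
  shows "Hausdorff_space (bounded_cohomology G act 2)"
proof -
  interpret banach_module G act by (rule assms(1))
  have T: "[a, b] \<in> tuples G 2" if "a \<in> carrier G" "b \<in> carrier G" for a b
    using that by (simp add: tuples_def)
  have T': "gs ! 0 \<in> carrier G" "gs ! 1 \<in> carrier G" "gs = [gs ! 0, gs ! 1]" if "gs \<in> tuples G 2" for gs
    using that by (auto simp: tuples_def length_Suc_conv numeral_2_eq_2)
  show ?thesis
  proof (rule Hausdorff_space_bounded_cohomology)
    have "(\<lambda>gs\<in>tuples G 2. 0) = (\<lambda>gs\<in>tuples G 2. defect G act (\<lambda>_. 0) (gs ! 0) (gs ! 1))"
      by (rule restrict_ext) (auto simp: defect_def linear_0[OF linear_act] dest: T'(1))
    then show "(\<lambda>gs\<in>tuples G 2. 0) \<in> coboundaries G act 2"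
      unfolding coboundaries_2 by (auto simp: image_constant_conv intro!: exI[of _ "\<lambda>_. 0"])
  next
    fix b c assume "b \<in> coboundaries G act 2" "c \<in> coboundaries G act 2"
    then obtain f g where fg: "bounded (f ` carrier G)" "bounded (g ` carrier G)"
      and bc: "b = (\<lambda>gs\<in>tuples G 2. defect G act f (gs ! 0) (gs ! 1))"
        "c = (\<lambda>gs\<in>tuples G 2. defect G act g (gs ! 0) (gs ! 1))"
      unfolding coboundaries_2 by blast
    have "(\<lambda>gs\<in>tuples G 2. b gs - c gs)
        = (\<lambda>gs\<in>tuples G 2. defect G act (\<lambda>a. f a - g a) (gs ! 0) (gs ! 1))"
      unfolding bc by (rule restrict_ext) (simp add: defect_diff T')
    then show "(\<lambda>gs\<in>tuples G 2. b gs - c gs) \<in> coboundaries G act 2"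
      unfolding coboundaries_2 using bounded_minus_comp[OF fg] by blast
  next
    fix h :: "'g list \<Rightarrow> 'e"
    assume h: "h \<in> extensional (tuples G 2)"
      and approx: "\<And>\<epsilon>::real. \<epsilon> > 0 \<Longrightarrow>
        \<exists>b\<in>coboundaries G act 2. \<forall>gs\<in>tuples G 2. norm (h gs - b gs) \<le> \<epsilon>"
    \<comment> \<open>Read as a function of two group elements, \<open>h\<close> is a uniform limit
      of defects, to which the closed range applies.\<close>
    have "\<exists>f. bounded (f ` carrier G) \<and>
      (\<forall>a\<in>carrier G. \<forall>b\<in>carrier G. norm (h [a, b] - defect G act f a b) \<le> \<epsilon>)"
      if "\<epsilon> > 0" for \<epsilon> :: real
    proof -
      obtain f where "bounded (f ` carrier G)" and f: "\<And>gs. gs \<in> tuples G 2 \<Longrightarrow>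
          norm (h gs - defect G act f (gs ! 0) (gs ! 1)) \<le> \<epsilon>"
        using approx[OF \<open>\<epsilon> > 0\<close>] unfolding coboundaries_2 by auto
      moreover have "norm (h [a, b] - defect G act f a b) \<le> \<epsilon>"
        if "a \<in> carrier G" "b \<in> carrier G" for a b
        using f[OF T[OF that]] by simp
      ultimately show ?thesis by blast
    qed
    then obtain f where f: "bounded (f ` carrier G)"
      "\<And>a b. a \<in> carrier G \<Longrightarrow> b \<in> carrier G \<Longrightarrow> defect G act f a b = h [a, b]"
      using defect_range_closed[OF assms(2), of "\<lambda>a b. h [a, b]"] by blast
    have "h = (\<lambda>gs\<in>tuples G 2. defect G act f (gs ! 0) (gs ! 1))"
    proof (rule extensionalityI[OF h restrict_extensional])
      fix gs assume gs: "gs \<in> tuples G 2"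
      then show "h gs = (\<lambda>gs\<in>tuples G 2. defect G act f (gs ! 0) (gs ! 1)) gs"
        using f(2)[OF T'(1,2)[OF gs]] T'(3)[OF gs] by simp
    qed
    with f(1) show "h \<in> coboundaries G act 2"
      unfolding coboundaries_2 by blast
  qed
qed

end
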